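(* Let $\mathbb{F}$ be a field, let $n\ge 1$, and let $A=(a_{i,j})$ be an $n\times n$ matrix with entries in $\mathbb{F}$. Then \[ \det(A)=\sum_{P\in\operatorname{PP}(n)}\operatorname{sgn}(P)\,|P|!\,\prod_{i=1}^n \begin{cases} \displaystyle\sum_{j\sim_P i,\ j\neq i} a_{i,j} & \text{if } i\sim_P i,\\[2mm] \displaystyle a_{i,i}+\sum_{j:\ j\sim_P j} a_{i,j} & \text{if } i\not\sim_P i,\end{cases} \] where $\operatorname{sgn}(P)=\prod_{S\in P}(-1)^{|S|+1}$.
   Context: $[n]=\{1,\dots,n\}$. A partial partition of $[n]$ is a set $P$ of pairwise disjoint nonempty subsets (parts) of $[n]$ (their union need not be $[n]$); $\operatorname{PP}(n)$ is the set of all partial partitions of $[n]$ and $|P|$ is the number of parts of $P$. For $i,j\in[n]$, write $i\sim_P j$ if some part of $P$ contains both $i$ and $j$ (so $i\sim_P i$ holds iff $i$ lies in some part of $P$). Empty sums are $0$ and $0!=1$. *)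

theory Defs
  imports "Jordan_Normal_Form.Determinant" "HOL-Library.Disjoint_Sets"
begin

definition partial_partitions :: "nat \<Rightarrow> nat set set set" where
  "partial_partitions n = {P. P \<subseteq> Pow {1..n} \<and> {} \<notin> P \<and> disjoint P}"

definition same_part :: "nat set set \<Rightarrow> nat \<Rightarrow> nat \<Rightarrow> bool" where
  "same_part P i j \<longleftrightarrow> (\<exists>S\<in>P. i \<in> S \<and> j \<in> S)"

definition pp_sign :: "nat set set \<Rightarrow> 'a::comm_ring_1" where
  "pp_sign P = (\<Prod>S\<in>P. (-1) ^ (card S + 1))"

(* Indices run over {1..n}, whereas the library's matrices are indexed from 0. *)
definition entry :: "'a mat \<Rightarrow> nat \<Rightarrow> nat \<Rightarrow> 'a" where
  "entry A i j = A $$ (i - 1, j - 1)"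

end

theory Submission imports Defs begin

text \<open>
  Expand the products and compare the coefficients of \<open>\<Prod>i. a i (f i)\<close> for every self-map \<open>f\<close> of
  \<open>{1..n}\<close>. If some \<open>x\<close> is not in the range of \<open>f\<close>, then adding \<open>x\<close> to, or deleting it from, the part
  of \<open>f x\<close> is a sign-reversing involution on the contributing partial partitions, so the coefficient
  vanishes. If \<open>f\<close> is a permutation, the contributing partial partitions are the partitions of the set
  of non-fixed points into \<open>f\<close>-invariant parts. The sum of \<open>(-1)\<^sup>k k!\<close> over the invariant partitions of
  an invariant set \<open>U\<close>, \<open>k\<close> being the number of parts, satisfies the recursion that its sums over all
  invariant subsets of \<open>U \<noteq> {}\<close> are zero. The function \<open>S \<mapsto> (-1)\<^bsup>|S|\<^esup> sgn (f restricted to S)\<close>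
  satisfies the same recursion, because it comes from expanding the determinant of the singular matrix
  \<open>I - (permutation matrix of f on U)\<close>.
\<close>

section \<open>Determinants with indices starting at one\<close>

text \<open>Conjugation by \<open>Suc\<close> carries permutations of \<open>{0..<n}\<close> to
  permutations of \<open>{1..n}\<close> and preserves the sign.\<close>

lemma det_entry:
  assumes "A \<in> carrier_mat n n"
  shows "det A = (\<Sum>p | p permutes {1..n}. of_int (sign p) * (\<Prod>i=1..n. entry A i (p i)))"
proof -
  have bij: "bij_betw Suc {0..<n} {1..n}"
    by (auto simp: bij_betw_def image_Suc_atLeastLessThan atLeastLessThanSuc_atLeastAtMost)
  have bij': "bij_betw (\<lambda>i. i - 1) {1..n} {0..<n}"
    by (rule bij_betw_byWitness[of _ Suc]) auto
  note inj = bij_betw_imp_inj_on[OF bij]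
  show ?thesis
    unfolding det_def'[OF assms]
  proof (rule sum.reindex_bij_witness[where j = "map_permutation {0..<n} Suc"
        and i = "map_permutation {1..n} (\<lambda>i. i - 1)"], goal_cases)
    case (1 p)
    then show ?case
      by (intro map_permutation_compose_inv[OF bij]) auto
  next
    case (2 p)
    then show ?case
      by (simp add: map_permutation_permutes[OF bij] del: One_nat_def)
  next
    case (3 p)
    then show ?case
      by (intro map_permutation_compose_inv[OF bij']) auto
  next
    case (4 p)
    then show ?case
      by (simp add: map_permutation_permutes[OF bij'] del: One_nat_def)
  next
    case (5 p)
    then have p: "p permutes {0..<n}" by simp
    have "(\<Prod>i=1..n. entry A i (map_permutation {0..<n} Suc p i))
        = (\<Prod>i\<in>{0..<n}. entry A (Suc i) (map_permutation {0..<n} Suc p (Suc i)))"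
      by (rule prod.reindex_bij_betw[OF bij, symmetric])
    also have "\<dots> = (\<Prod>i\<in>{0..<n}. A $$ (i, p i))"
      by (intro prod.cong) (auto simp: map_permutation_apply[OF inj] entry_def)
    finally show ?case
      using sign_map_permutation[OF inj p] by simp
  qed
qed

section \<open>Signs of the restrictions of a permutation\<close>

text \<open>The sum is the determinant of the identity matrix minus the permutation matrix of \<open>p\<close> on
  \<open>U\<close>, whose kernel contains the indicator vector of \<open>U\<close>.\<close>

lemma sum_sign_restrict_id:
  fixes p :: "nat \<Rightarrow> nat"
  assumes p: "p permutes {1..n}" and U: "U \<subseteq> {1..n}" "p ` U = U" "U \<noteq> {}"
    and nofix: "\<And>i. i \<in> U \<Longrightarrow> p i \<noteq> i"
  shows "(\<Sum>S | S \<subseteq> U \<and> p ` S = S. (-1) ^ card S * of_int (sign (restrict_id p S))) = (0 :: 'a::field)"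
proof -
  \<comment> \<open>Indices of \<open>m\<close> start at one. Rows outside \<open>U\<close> are rows
    of the identity, so the determinant is that of the block on \<open>U\<close>.\<close>
  define m :: "nat \<Rightarrow> nat \<Rightarrow> 'a" where
    "m = (\<lambda>i j. of_bool (i = j) - of_bool (i \<in> U \<and> p i = j))"
  define M where "M = mat n n (\<lambda>(i, j). m (Suc i) (Suc j))"
  define v :: "'a vec" where "v = vec n (\<lambda>i. of_bool (Suc i \<in> U))"
  have M: "M \<in> carrier_mat n n" by (simp add: M_def)
  have "M *\<^sub>v v = 0\<^sub>v n"
  proof (rule eq_vecI)
    fix i assume "i < dim_vec (0\<^sub>v n :: 'a vec)"
    then have i: "i < n" by simp
    have "(M *\<^sub>v v) $ i = (\<Sum>j\<in>{0..<n}. m (Suc i) (Suc j) * of_bool (Suc j \<in> U))"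
      using i by (simp add: M_def v_def scalar_prod_def)
    also have "\<dots> = (\<Sum>j\<in>{1..n}. m (Suc i) j * of_bool (j \<in> U))"
      by (rule sum.reindex_bij_witness[of _ "\<lambda>j. j - 1" Suc]) auto
    also have "\<dots> = (\<Sum>j\<in>{1..n}. of_bool (Suc i = j) * of_bool (j \<in> U))
        - (\<Sum>j\<in>{1..n}. of_bool (Suc i \<in> U \<and> p (Suc i) = j) * of_bool (j \<in> U))"
      by (simp add: m_def left_diff_distrib sum_subtractf)
    also have "(\<Sum>j\<in>{1..n}. of_bool (Suc i = j) * of_bool (j \<in> U)) = (of_bool (Suc i \<in> U) :: 'a)"
      using i by (subst sum.remove[of _ "Suc i"]) (auto intro!: sum.neutral)
    also have "(\<Sum>j\<in>{1..n}. of_bool (Suc i \<in> U \<and> p (Suc i) = j) * of_bool (j \<in> U))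
        = (of_bool (Suc i \<in> U) :: 'a)"
    proof (cases "Suc i \<in> U")
      case True
      then have "p (Suc i) \<in> U" using U(2) by blast
      with True U(1) show ?thesis
        by (subst sum.remove[of _ "p (Suc i)"]) (auto intro!: sum.neutral)
    qed simp
    finally show "(M *\<^sub>v v) $ i = 0\<^sub>v n $ i" using i by simp
  qed (simp add: M_def)
  moreover have "v \<noteq> 0\<^sub>v n"
  proof -
    obtain u where u: "u \<in> U" using U(3) by blast
    then have "1 \<le> u" "u \<le> n" using U(1) by auto
    then have "v $ (u - 1) = 1" "0\<^sub>v n $ (u - 1) = (0 :: 'a)" using u by (auto simp: v_def)
    then show ?thesis by auto
  qed
  moreover have "v \<in> carrier_vec n" by (simp add: v_def)
  ultimately have "det M = 0" using det_0_iff_vec_prod_zero[OF M] by blast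
  then have "0 = (\<Sum>q | q permutes {1..n}. of_int (sign q) * (\<Prod>i=1..n. entry M i (q i)))"
    using det_entry[OF M] by simp
  also have "\<dots> = (\<Sum>q | q permutes {1..n}. of_int (sign q) * (\<Prod>i=1..n. m i (q i)))"
  proof (intro sum.cong refl arg_cong2[where f = times] prod.cong)
    fix q i assume "q \<in> {q. q permutes {1..n}}" and i: "i \<in> {1..n}"
    then have "q i \<in> {1..n}" using permutes_in_image[of q "{1..n}" i] by simp
    with i have "i - 1 < n" "q i - 1 < n" "Suc (i - 1) = i" "Suc (q i - 1) = q i" by auto
    then show "entry M i (q i) = m i (q i)" by (simp add: entry_def M_def)
  qed
  finally have zero_sum: "0 = (\<Sum>q | q permutes {1..n}. of_int (sign q) * (\<Prod>i=1..n. m i (q i)))" .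
  have moved: "q i = p i \<and> i \<in> U"
    if "q permutes {1..n}" "(\<Prod>i=1..n. m i (q i)) \<noteq> 0" "q i \<noteq> i" for q i
  proof -
    have "i \<in> {1..n}" using permutes_not_in[OF that(1)] that(3) by metis
    with that(2) have "m i (q i) \<noteq> 0" by (metis finite_atLeastAtMost prod_zero_iff)
    with that(3) show ?thesis by (auto simp: m_def split: if_splits)
  qed
  note zero_sum
  also have "(\<Sum>q | q permutes {1..n}. of_int (sign q) * (\<Prod>i=1..n. m i (q i)))
      = (\<Sum>q | q permutes {1..n} \<and> (\<Prod>i=1..n. m i (q i)) \<noteq> 0.
          of_int (sign q) * (\<Prod>i=1..n. m i (q i)))"
    by (rule sum.mono_neutral_right) (auto simp: finite_permutations)
  also have "\<dots> = (\<Sum>S | S \<subseteq> U \<and> p ` S = S. (-1) ^ card S * of_int (sign (restrict_id p S)))"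
  \<comment> \<open>A surviving \<open>q\<close> is determined by the set of points it moves, since
    it agrees with \<open>p\<close> there. As \<open>p\<close> has no fixed point in
    \<open>U\<close>, every invariant \<open>S\<close> arises as such a set.\<close>
  proof (rule sum.reindex_bij_witness[where j = "\<lambda>q. {i. q i \<noteq> i}" and i = "restrict_id p"], goal_cases)
    case (1 q)
    then have "q i = p i" if "q i \<noteq> i" for i using moved[of q i] that by simp
    then show ?case by (auto simp: restrict_id_def fun_eq_iff)
  next
    case (2 q)
    then have q: "q permutes {1..n}" by simp
    have *: "q i = p i \<and> i \<in> U" if "q i \<noteq> i" for i
      using moved[of q i] that 2 by simp
    have "q ` {i. q i \<noteq> i} = {i. q i \<noteq> i}"
    proof -
      have "j \<in> q ` {i. q i \<noteq> i}" if "q j \<noteq> j" for j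
      proof -
        obtain k where "j = q k" using permutes_surj[OF q] by (metis surj_def)
        then show ?thesis using that by auto
      qed
      moreover have "q (q i) \<noteq> q i" if "q i \<noteq> i" for i
        using that permutes_inj[OF q] by (auto dest: injD)
      ultimately show ?thesis by auto
    qed
    moreover have "p ` {i. q i \<noteq> i} = q ` {i. q i \<noteq> i}"
      using * by (intro image_cong) auto
    ultimately show ?case using * by auto
  next
    case (3 S)
    then show ?case using nofix by (auto simp: restrict_id_def)
  next
    case (4 S)
    then have S: "S \<subseteq> U" "p ` S = S" by auto
    then have "bij_betw p S S" using permutes_inj_on[OF p] by (auto simp: bij_betw_def)
    then have "restrict_id p S permutes S" by (rule permutes_restrict_id)
    then have "restrict_id p S permutes {1..n}"
      by (rule permutes_subset) (use S U(1) in auto)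
    moreover have "m i (restrict_id p S i) \<noteq> 0" for i
      using S(1) nofix[of i] by (cases "i \<in> S") (auto simp: m_def)
    ultimately show ?case by auto
  next
    case (5 q)
    then have q: "q permutes {1..n}" by simp
    have *: "q i = p i \<and> i \<in> U" if "q i \<noteq> i" for i
      using moved[of q i] that 5 by simp
    then have "q = restrict_id p {i. q i \<noteq> i}" by (auto simp: restrict_id_def fun_eq_iff)
    then have sgn: "sign (restrict_id p {i. q i \<noteq> i}) = sign q" by simp
    \<comment> \<open>Diagonal entries are 1, again because \<open>p\<close> fixes no point of
      \<open>U\<close>; each moved point contributes -1.\<close>
    have "(\<Prod>i=1..n. m i (q i)) = (\<Prod>i\<in>{i. q i \<noteq> i}. m i (q i))"
    proof (rule prod.mono_neutral_right)
      show "{i. q i \<noteq> i} \<subseteq> {1..n}" using permutes_not_in[OF q] by blast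
      show "\<forall>i\<in>{1..n} - {i. q i \<noteq> i}. m i (q i) = 1"
        using nofix by (auto simp: m_def)
    qed simp
    also have "\<dots> = (\<Prod>i\<in>{i. q i \<noteq> i}. -1)"
      by (intro prod.cong) (auto simp: m_def dest: *)
    finally show ?case using sgn by simp
  qed
  finally show ?thesis by simp
qed

section \<open>Partitions into invariant parts\<close>

definition invariant_partitions :: "('b \<Rightarrow> 'b) \<Rightarrow> 'b set \<Rightarrow> 'b set set set" where
  "invariant_partitions p U = {P. partition_on U P \<and> (\<forall>S\<in>P. p ` S = S)}"

lemma invariant_partitions_empty [simp]: "invariant_partitions p {} = {{}}"
  by (auto simp: invariant_partitions_def partition_on_def)

lemma finite_invariant_partitions: "finite U \<Longrightarrow> finite (invariant_partitions p U)"
  by (rule finite_subset[of _ "Pow (Pow U)"])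
    (auto simp: invariant_partitions_def partition_on_def)

lemma finite_in_invariant_partitions:
  "finite U \<Longrightarrow> P \<in> invariant_partitions p U \<Longrightarrow> finite P"
  by (rule finite_subset[of _ "Pow U"]) (auto simp: invariant_partitions_def partition_on_def)

text \<open>The factorial counts the orderings of the parts, so this is a signed count of ordered
  invariant partitions. Without signs and invariance it would be a Fubini (ordered Bell)
  number.\<close>

definition signed_fubini :: "('b \<Rightarrow> 'b) \<Rightarrow> 'b set \<Rightarrow> 'a::comm_ring_1" where
  "signed_fubini p U = (\<Sum>P\<in>invariant_partitions p U. (-1) ^ card P * of_nat (fact (card P)))"

text \<open>Since \<open>k! = k \<cdot> (k - 1)!\<close>, the weight of a partition is shared equally among its parts;
  deleting the distinguished part gives the recursion.\<close>

lemma signed_fubini_rec: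
  assumes fin: "finite U" and inj: "inj p" and U: "p ` U = U" "U \<noteq> {}"
  shows "signed_fubini p U = - (\<Sum>T | T \<subset> U \<and> p ` T = T. signed_fubini p T :: 'a::comm_ring_1)"
proof -
  let ?w = "\<lambda>k. (-1) ^ k * of_nat (fact k) :: 'a"
  have "signed_fubini p U
      = (\<Sum>P\<in>invariant_partitions p U. \<Sum>S\<in>P. (-1) ^ card P * of_nat (fact (card P - 1)) :: 'a)"
    unfolding signed_fubini_def
  proof (rule sum.cong)
    fix P assume P: "P \<in> invariant_partitions p U"
    then have "finite P" using finite_in_invariant_partitions[OF fin] by blast
    moreover have "P \<noteq> {}" using P U(2) by (auto simp: invariant_partitions_def partition_on_def)
    ultimately have "card P > 0" by (simp add: card_gt_0_iff)
    then have "fact (card P) = card P * fact (card P - 1)" by (simp add: fact_reduce)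
    then show "?w (card P) = (\<Sum>S\<in>P. (-1) ^ card P * of_nat (fact (card P - 1)))"
      by (simp add: algebra_simps)
  qed simp
  also have "\<dots> = (\<Sum>(P, S)\<in>Sigma (invariant_partitions p U) (\<lambda>P. P).
      (-1) ^ card P * of_nat (fact (card P - 1)))"
    by (rule sum.Sigma)
      (use finite_invariant_partitions[OF fin] finite_in_invariant_partitions[OF fin] in blast)+
  also have "\<dots> = (\<Sum>(T, Q)\<in>Sigma {T. T \<subset> U \<and> p ` T = T} (invariant_partitions p). - ?w (card Q))"
  \<comment> \<open>\<open>U - S\<close> is a proper subset because parts are nonempty. Conversely,
    \<open>U - T\<close> is nonempty and disjoint from the parts of \<open>Q\<close>, so inserting
    it adds exactly one part; this accounts for the change of sign.\<close>
  proof (rule sum.reindex_bij_witness[where j = "\<lambda>(P, S). (U - S, P - {S})"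
        and i = "\<lambda>(T, Q). (insert (U - T) Q, U - T)"], goal_cases)
    case (1 x)
    then obtain P S where [simp]: "x = (P, S)" and S: "S \<in> P" and P: "\<Union>P = U"
      by (auto simp: invariant_partitions_def partition_on_def)
    then have "U - (U - S) = S" by blast
    with S show ?case by auto
  next
    case (2 x)
    then obtain P S where [simp]: "x = (P, S)" and S: "S \<in> P" and P: "\<Union>P = U" "disjoint P" "{} \<notin> P"
      and inv: "\<And>S. S \<in> P \<Longrightarrow> p ` S = S"
      by (auto simp: invariant_partitions_def partition_on_def)
    have Un: "\<Union>(P - {S}) = U - S"
      using S P(1,2) by (auto simp: disjoint_def)
    have "p ` (U - S) = U - S"
      using image_set_diff[OF inj] U(1) inv[OF S] by simp
    moreover have "S \<noteq> {}" "S \<subseteq> U" using S P by auto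
    then have "U - S \<subset> U" by blast
    moreover have "P - {S} \<in> invariant_partitions p (U - S)"
      using Un P inv by (auto simp: invariant_partitions_def partition_on_def disjoint_def)
    ultimately show ?case by auto
  next
    case (3 x)
    then obtain T Q where [simp]: "x = (T, Q)" and T: "T \<subset> U" and "Q \<in> invariant_partitions p T"
      by blast
    then have Q: "\<Union>Q = T" by (simp add: invariant_partitions_def partition_on_def)
    have "U - T \<notin> Q" using T Q by blast
    moreover have "U - (U - T) = T" using T by blast
    ultimately show ?case by auto
  next
    case (4 x)
    then obtain T Q where [simp]: "x = (T, Q)" and T: "T \<subset> U" "p ` T = T"
      and "Q \<in> invariant_partitions p T"
      by blast
    then have Q: "\<Union>Q = T" "disjoint Q" "{} \<notin> Q" and inv: "\<And>S. S \<in> Q \<Longrightarrow> p ` S = S"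
      by (auto simp: invariant_partitions_def partition_on_def)
    have "p ` (U - T) = U - T"
      using image_set_diff[OF inj] U(1) T(2) by simp
    moreover have "disjoint (insert (U - T) Q)"
      using Q(1,2) by (auto simp: disjoint_def)
    moreover have "\<Union>(insert (U - T) Q) = U" using T(1) Q(1) by blast
    moreover have "U - T \<noteq> {}" using T(1) by blast
    ultimately show ?case
      using Q(3) inv by (auto simp: invariant_partitions_def partition_on_def)
  next
    case (5 x)
    then obtain P S where [simp]: "x = (P, S)" and S: "S \<in> P" and P: "P \<in> invariant_partitions p U"
      by auto
    have "finite P" using P finite_in_invariant_partitions[OF fin] by blast
    then obtain k where "card P = Suc k" "card (P - {S}) = k"
      using S by (metis card.remove card_Diff_singleton diff_Suc_1)
    then show ?case by simp
  qed
  also have "\<dots> = (\<Sum>T | T \<subset> U \<and> p ` T = T. \<Sum>Q\<in>invariant_partitions p T. - ?w (card Q))"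
  proof (rule sum.Sigma[symmetric])
    show "finite {T. T \<subset> U \<and> p ` T = T}"
      by (rule finite_subset[of _ "Pow U"]) (use fin in auto)
  qed (use finite_invariant_partitions[OF finite_subset[OF _ fin]] in auto)
  also have "\<dots> = - (\<Sum>T | T \<subset> U \<and> p ` T = T. signed_fubini p T)"
    by (simp add: signed_fubini_def sum_negf)
  finally show ?thesis .
qed

text \<open>Both sides are 1 on the empty set and obey the same recursion over proper invariant
  subsets, so induction on proper subsets identifies them.\<close>

lemma signed_fubini_eq_sign:
  fixes p :: "nat \<Rightarrow> nat"
  assumes p: "p permutes {1..n}" and "U \<subseteq> {1..n}" "p ` U = U" "\<And>i. i \<in> U \<Longrightarrow> p i \<noteq> i"
  shows "signed_fubini p U = ((-1) ^ card U * of_int (sign (restrict_id p U)) :: 'a::field)"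
proof -
  have "finite U" using finite_subset[OF assms(2)] by simp
  then show ?thesis using assms(2-)
  proof (induction U rule: finite_psubset_induct)
    case (psubset U)
    show ?case
    proof (cases "U = {}")
      case True
      have "restrict_id p {} = id" by (auto simp: restrict_id_def)
      with True show ?thesis by (simp add: signed_fubini_def)
    next
      case False
      let ?X = "\<lambda>S. (-1) ^ card S * of_int (sign (restrict_id p S)) :: 'a"
      have "signed_fubini p U = - (\<Sum>T | T \<subset> U \<and> p ` T = T. signed_fubini p T :: 'a)"
        by (rule signed_fubini_rec[OF psubset.hyps permutes_inj[OF p] psubset.prems(2) False])
      also have "\<dots> = - (\<Sum>T | T \<subset> U \<and> p ` T = T. ?X T)"
      proof (intro arg_cong[where f = uminus] sum.cong refl)
        fix T assume "T \<in> {T. T \<subset> U \<and> p ` T = T}"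
        with psubset.prems show "signed_fubini p T = ?X T"
          by (intro psubset.IH) auto
      qed
      \<comment> \<open>The sum over all invariant subsets vanishes, so the proper ones sum to minus
        the term of \<open>U\<close>.\<close>
      also have "\<dots> = ?X U - (\<Sum>T | T \<subseteq> U \<and> p ` T = T. ?X T)"
      proof -
        have "{T. T \<subseteq> U \<and> p ` T = T} - {U} = {T. T \<subset> U \<and> p ` T = T}" by blast
        then show ?thesis
          using psubset.hyps psubset.prems(2) by (subst (2) sum.remove[of _ U]) auto
      qed
      also have "(\<Sum>T | T \<subseteq> U \<and> p ` T = T. ?X T) = 0"
        by (rule sum_sign_restrict_id[OF p psubset.prems(1,2) False psubset.prems(3)])
      finally show ?thesis by simp
    qed
  qed
qed

section \<open>The coefficient of a monomial\<close>

text \<open>The partial partitions whose product contains the monomial \<open>\<Prod>i. a i (f i)\<close>.\<close>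

definition compatible :: "nat \<Rightarrow> (nat \<Rightarrow> nat) \<Rightarrow> nat set set set" where
  "compatible n f = {P \<in> partial_partitions n. \<forall>i\<in>{1..n}.
     if same_part P i i then same_part P (f i) i \<and> f i \<noteq> i
     else f i = i \<or> same_part P (f i) (f i)}"

lemma finite_partial_partitions: "finite (partial_partitions n)"
  by (rule finite_subset[of _ "Pow (Pow {1..n})"]) (auto simp: partial_partitions_def)

lemma finite_compatible: "finite (compatible n f)"
  by (rule finite_subset[OF _ finite_partial_partitions]) (auto simp: compatible_def)

lemma same_part_refl_iff: "same_part P i i \<longleftrightarrow> i \<in> \<Union>P"
  by (auto simp: same_part_def)

text \<open>Sizes of disjoint parts add up, so the sign depends only on the size of the union and
  the number of parts.\<close>

lemma pp_sign_eq:
  assumes "P \<in> partial_partitions n"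
  shows "pp_sign P = ((-1) ^ card (\<Union>P) * (-1) ^ card P :: 'a::comm_ring_1)"
proof -
  have P: "P \<subseteq> Pow {1..n}" "disjoint P" using assms by (auto simp: partial_partitions_def)
  have "card (\<Union>P) = (\<Sum>S\<in>P. card S)"
    using P finite_subset[of _ "{1..n}"]
    by (intro card_Union_disjoint) (auto simp: pairwise_def disjoint_def disjnt_def)
  then show ?thesis
    by (simp only: pp_sign_def power_add prod.distrib power_sum prod_constant power_one_right)
qed

text \<open>Compatibility puts \<open>p i\<close> in the part of \<open>i\<close>, so parts are
  invariant by injectivity and finiteness. A moved point outside all parts would have its image in
  an invariant part and hence lie in that part itself.\<close>

lemma compatible_permutation:
  assumes p: "p permutes {1..n}"
  shows "compatible n p = invariant_partitions p {i\<in>{1..n}. p i \<noteq> i}"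
proof (intro equalityI subsetI)
  fix P assume P: "P \<in> compatible n p"
  then have sub: "P \<subseteq> Pow {1..n}" and ne: "{} \<notin> P" and dis: "disjoint P"
    by (auto simp: compatible_def partial_partitions_def)
  have inside: "p i \<in> S \<and> p i \<noteq> i" if "S \<in> P" "i \<in> S" for S i
  proof -
    have "i \<in> {1..n}" using that sub by blast
    moreover have "same_part P i i" using that by (auto simp: same_part_def)
    ultimately have "same_part P (p i) i" "p i \<noteq> i" using P by (auto simp: compatible_def)
    then obtain S' where "S' \<in> P" "p i \<in> S'" "i \<in> S'" by (auto simp: same_part_def)
    with that dis \<open>p i \<noteq> i\<close> show ?thesis by (auto simp: disjoint_def)
  qed
  have inv: "p ` S = S" if "S \<in> P" for S
  proof (rule endo_inj_surj)
    show "finite S" using that sub finite_subset[of S "{1..n}"] by auto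
  qed (use that inside permutes_inj_on[OF p] in auto)
  have "i \<in> \<Union>P" if i: "i \<in> {1..n}" "p i \<noteq> i" for i
  proof (rule ccontr)
    assume no: "i \<notin> \<Union>P"
    have "if i \<in> \<Union>P then same_part P (p i) i \<and> p i \<noteq> i else p i = i \<or> p i \<in> \<Union>P"
      using P i(1) unfolding compatible_def same_part_refl_iff by blast
    with no have "p i = i \<or> p i \<in> \<Union>P" by (simp only: if_False)
    with i(2) have "p i \<in> \<Union>P" by blast
    then obtain S where S: "S \<in> P" "p i \<in> p ` S" using inv by blast
    then have "i \<in> S" using permutes_inj[OF p] by (auto dest: injD)
    with S no show False by blast
  qed
  then have "\<Union>P = {i\<in>{1..n}. p i \<noteq> i}" using inside sub by blast
  then show "P \<in> invariant_partitions p {i\<in>{1..n}. p i \<noteq> i}"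
    using inv ne dis by (auto simp: invariant_partitions_def partition_on_def)
next
  fix P assume "P \<in> invariant_partitions p {i\<in>{1..n}. p i \<noteq> i}"
  then have Un: "\<Union>P = {i\<in>{1..n}. p i \<noteq> i}" and dis: "disjoint P" "{} \<notin> P"
    and inv: "\<And>S. S \<in> P \<Longrightarrow> p ` S = S"
    by (auto simp: invariant_partitions_def partition_on_def)
  have "same_part P (p i) i" if "i \<in> \<Union>P" for i
    using that inv by (auto simp: same_part_def)
  moreover have "P \<in> partial_partitions n"
    using Un dis by (auto simp: partial_partitions_def)
  ultimately show "P \<in> compatible n p"
    using Un by (auto simp: compatible_def same_part_refl_iff)
qed

text \<open>All compatible \<open>P\<close> have the same union \<open>U\<close>; its factor
  \<open>(-1) ^ card U\<close> cancels the one in \<open>signed_fubini_eq_sign\<close>.\<close>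

lemma sum_compatible_permutation:
  assumes p: "p permutes {1..n}"
  shows "(\<Sum>P\<in>compatible n p. pp_sign P * of_nat (fact (card P))) = (of_int (sign p) :: 'a::field)"
proof -
  define U where "U = {i\<in>{1..n}. p i \<noteq> i}"
  have eq: "compatible n p = invariant_partitions p U"
    using compatible_permutation[OF p] by (simp add: U_def)
  have inv: "p ` U = U"
  proof (rule endo_inj_surj)
    show "p ` U \<subseteq> U"
      using permutes_in_image[OF p] permutes_inj[OF p] by (auto simp: U_def dest: injD)
  qed (use permutes_inj_on[OF p] in \<open>auto simp: U_def\<close>)
  have id: "restrict_id p U = p"
    using permutes_not_in[OF p] by (auto simp: restrict_id_def U_def fun_eq_iff)
  have "(\<Sum>P\<in>compatible n p. pp_sign P * of_nat (fact (card P)) :: 'a)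
      = (\<Sum>P\<in>compatible n p. (-1) ^ card U * ((-1) ^ card P * of_nat (fact (card P))))"
  proof (rule sum.cong[OF refl])
    fix P assume P: "P \<in> compatible n p"
    then have "\<Union>P = U" unfolding eq by (auto simp: invariant_partitions_def partition_on_def)
    moreover have "P \<in> partial_partitions n" using P by (simp add: compatible_def)
    ultimately show "pp_sign P * of_nat (fact (card P))
        = ((-1) ^ card U * ((-1) ^ card P * of_nat (fact (card P))) :: 'a)"
      by (simp add: pp_sign_eq mult.assoc)
  qed
  also have "\<dots> = (-1) ^ card U * signed_fubini p U"
    by (simp add: eq signed_fubini_def sum_distrib_left)
  also have "\<dots> = (-1) ^ card U * ((-1) ^ card U * of_int (sign (restrict_id p U)))"
    by (subst signed_fubini_eq_sign[OF p _ inv]) (auto simp: U_def)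
  also have "\<dots> = of_int (sign p)"
    by (simp add: id flip: mult.assoc power_mult_distrib)
  finally show ?thesis .
qed

section \<open>Cancellation for maps that miss a point\<close>

definition toggle :: "'b \<Rightarrow> 'b \<Rightarrow> 'b set \<Rightarrow> 'b set" where
  "toggle x y S = (if y \<in> S then if x \<in> S then S - {x} else insert x S else S)"

lemma toggle_toggle: "x \<noteq> y \<Longrightarrow> toggle x y (toggle x y S) = S"
  by (auto simp: toggle_def)

lemma mem_toggle_other: "i \<noteq> x \<Longrightarrow> i \<in> toggle x y S \<longleftrightarrow> i \<in> S"
  by (auto simp: toggle_def)

lemma image_toggle_toggle: "x \<noteq> y \<Longrightarrow> toggle x y ` toggle x y ` P = P"
  by (simp add: image_image toggle_toggle)

lemma inj_toggle: "x \<noteq> y \<Longrightarrow> inj (toggle x y)"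
  by (rule inj_on_inverseI[of _ "toggle x y"]) (simp add: toggle_toggle)

context
  fixes n :: nat and f :: "nat \<Rightarrow> nat" and x :: nat
  assumes f: "f ` {1..n} \<subseteq> {1..n}" and x: "x \<in> {1..n}" "x \<notin> f ` {1..n}"
begin

lemma f_x_neq: "x \<noteq> f x"
  using x by auto

text \<open>Exactly one part changes, and its size changes by one. The condition at \<open>x\<close>
  holds on both sides of the move: either \<open>x\<close> shares a part with \<open>f x\<close>, or
  \<open>x\<close> is uncovered and \<open>f x\<close> is covered.\<close>

lemma toggle_partition:
  assumes P: "P \<in> compatible n f"
  shows "toggle x (f x) ` P \<in> compatible n f"
    and "x \<in> \<Union>(toggle x (f x) ` P) \<longleftrightarrow> x \<notin> \<Union>P"
    and "pp_sign (toggle x (f x) ` P) = - (pp_sign P :: 'a::comm_ring_1)"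
proof -
  let ?g = "toggle x (f x)"
  have sub: "P \<subseteq> Pow {1..n}" and ne: "{} \<notin> P" and dis: "disjoint P"
    using P by (auto simp: compatible_def partial_partitions_def)
  have fin: "finite P" using sub by (rule finite_subset) simp
  \<comment> \<open>Hence only the part of \<open>f x\<close> can contain \<open>x\<close>, which
    keeps the parts disjoint when \<open>x\<close> is added to it.\<close>
  have together: "f x \<in> S" if "S \<in> P" "x \<in> S" for S
  proof -
    have "same_part P x x" using that by (auto simp: same_part_def)
    with P x have "same_part P (f x) x" by (auto simp: compatible_def)
    with that dis show ?thesis by (auto simp: same_part_def disjoint_def)
  qed
  \<comment> \<open>This guarantees that there is a part to toggle.\<close>
  have "f x \<in> \<Union>P"
  proof (cases "same_part P x x")
    case True
    then show ?thesis using together by (auto simp: same_part_def)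
  next
    case False
    with P x(1) have "f x = x \<or> same_part P (f x) (f x)"
      by (auto simp: compatible_def simp del: One_nat_def)
    with f_x_neq show ?thesis by (auto simp: same_part_def)
  qed
  then obtain S where S: "S \<in> P" "f x \<in> S" by blast
  have only: "T = S" if "T \<in> P" "f x \<in> T" for T
    using that S dis by (auto simp: disjoint_def)
  have other: "?g T = T" if "T \<in> P" "T \<noteq> S" for T
    using only that by (auto simp: toggle_def)
  have not_x: "x \<notin> T" if "T \<in> P" "T \<noteq> S" for T
    using only together that by blast
  have gS: "?g S = (if x \<in> S then S - {x} else insert x S)" using S by (simp add: toggle_def)
  have same: "same_part (?g ` P) i j \<longleftrightarrow> same_part P i j" if "i \<noteq> x" "j \<noteq> x" for i j
    using that by (auto simp: same_part_def mem_toggle_other)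
  show "x \<in> \<Union>(?g ` P) \<longleftrightarrow> x \<notin> \<Union>P"
    using S gS other not_x by (auto split: if_splits)
  have pp: "?g ` P \<in> partial_partitions n"
  proof -
    have "?g T \<subseteq> {1..n}" if "T \<in> P" for T
      using that sub x(1) by (auto simp: toggle_def)
    moreover have "?g T \<noteq> {}" if "T \<in> P" for T
      using that ne f_x_neq by (auto simp: toggle_def)
    moreover have "disjoint (?g ` P)"
    proof (rule disjointI)
      fix a b assume ab: "a \<in> ?g ` P" "b \<in> ?g ` P" "a \<noteq> b"
      then obtain T T' where T: "T \<in> P" "T' \<in> P" "a = ?g T" "b = ?g T'" "T \<noteq> T'" by blast
      have "i \<notin> ?g T \<or> i \<notin> ?g T'" for i
      proof (cases "i = x")
        case True
        then show ?thesis using T other not_x by metis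
      next
        case False
        then show ?thesis using T dis by (auto simp: mem_toggle_other disjoint_def)
      qed
      then show "a \<inter> b = {}" using T by blast
    qed
    ultimately show ?thesis unfolding partial_partitions_def by blast
  qed
  have fxx: "same_part (?g ` P) (f x) (f x)"
    using S f_x_neq same[of "f x" "f x"] by (auto simp: same_part_def)
  have "same_part (?g ` P) (f x) x" if "same_part (?g ` P) x x"
  proof -
    have "x \<in> ?g S" using that other not_x unfolding same_part_def by (metis imageE)
    moreover have "f x \<in> ?g S" using S f_x_neq by (simp add: mem_toggle_other)
    ultimately show ?thesis using S(1) by (auto simp: same_part_def)
  qed
  \<comment> \<open>For \<open>i\<close> other than \<open>x\<close>, neither \<open>i\<close> nor
    \<open>f i\<close> is \<open>x\<close>, so by \<open>same\<close> the condition at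
    \<open>i\<close> is unaffected.\<close>
  moreover have "f i \<noteq> x" if "i \<in> {1..n}" for i using x(2) that by blast
  ultimately show "?g ` P \<in> compatible n f"
    using P pp fxx f_x_neq unfolding compatible_def mem_Collect_eq
    by (metis same)
  have "card (?g S) = card S + 1 \<or> card S = card (?g S) + 1"
  proof -
    have "finite S" using S sub finite_subset[of S "{1..n}"] by auto
    then show ?thesis using gS card_Suc_Diff1[of S x] by (cases "x \<in> S") simp_all
  qed
  then have flip: "(-1) ^ (card (?g S) + 1) = - ((-1) ^ (card S + 1) :: 'a)"
    by auto
  have "pp_sign (?g ` P) = (\<Prod>T\<in>P. (-1) ^ (card (?g T) + 1) :: 'a)"
    unfolding pp_sign_def
    by (subst prod.reindex) (use inj_toggle[OF f_x_neq] in \<open>auto intro: inj_on_subset\<close>)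
  also have "\<dots> = (-1) ^ (card (?g S) + 1) * (\<Prod>T\<in>P - {S}. (-1) ^ (card (?g T) + 1))"
    by (rule prod.remove[OF fin S(1)])
  also have "\<dots> = - ((-1) ^ (card S + 1)) * (\<Prod>T\<in>P - {S}. (-1) ^ (card T + 1))"
    unfolding flip by (intro arg_cong2[where f = times] prod.cong refl) (simp add: other)
  also have "\<dots> = - pp_sign P"
    unfolding pp_sign_def by (simp add: prod.remove[OF fin S(1)])
  finally show "pp_sign (?g ` P) = - (pp_sign P :: 'a)" .
qed

lemma sum_compatible_not_surj:
  "(\<Sum>P\<in>compatible n f. pp_sign P * of_nat (fact (card P))) = (0 :: 'a::comm_ring_1)"
proof -
  let ?g = "\<lambda>P. toggle x (f x) ` P"
  let ?w = "\<lambda>P. pp_sign P * of_nat (fact (card P)) :: 'a"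
  let ?C = "compatible n f"
  \<comment> \<open>Splitting by whether \<open>x\<close> is covered cancels terms in pairs; knowing
    only that the sum equals its own negative would not suffice in characteristic 2.\<close>
  have "(\<Sum>P\<in>?C. ?w P) = (\<Sum>P\<in>{P\<in>?C. x \<in> \<Union>P}. ?w P) + (\<Sum>P\<in>{P\<in>?C. x \<notin> \<Union>P}. ?w P)"
    by (subst sum.union_disjoint[symmetric])
      (auto simp: finite_compatible intro!: sum.cong)
  also have "(\<Sum>P\<in>{P\<in>?C. x \<notin> \<Union>P}. ?w P) = (\<Sum>P\<in>{P\<in>?C. x \<in> \<Union>P}. - ?w P)"
  proof (rule sum.reindex_bij_witness[where i = ?g and j = ?g], goal_cases)
    case (5 P)
    have "card (?g P) = card P"
      by (rule card_image) (use inj_toggle[OF f_x_neq] in \<open>auto intro: inj_on_subset\<close>)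
    with 5 toggle_partition(3)[of P, where 'a = 'a] show ?case by simp
  qed (use toggle_partition(1,2) image_toggle_toggle[OF f_x_neq] in blast)+
  finally show ?thesis by (simp add: sum_negf)
qed

end

section \<open>Expanding the product\<close>

theorem theorem2p1:
  fixes A :: "'a::field mat" and n :: nat
  assumes "n \<ge> 1" and "A \<in> carrier_mat n n"
  shows "det A =
    (\<Sum>P\<in>partial_partitions n. pp_sign P * of_nat (fact (card P)) *
      (\<Prod>i=1..n.
        if same_part P i i
        then (\<Sum>j\<in>{j\<in>{1..n}. same_part P j i \<and> j \<noteq> i}. entry A i j)
        else entry A i i + (\<Sum>j\<in>{j\<in>{1..n}. same_part P j j}. entry A i j)))"
proof -
  let ?N = "{1..n}"
  let ?w = "\<lambda>P. pp_sign P * of_nat (fact (card P)) :: 'a"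
  let ?a = "\<lambda>f. \<Prod>i\<in>?N. entry A i (f i)"
  \<comment> \<open>The columns that \<open>P\<close> allows in row \<open>i\<close>. For uncovered
    \<open>i\<close> the inner set does not contain \<open>i\<close>, so \<open>insert\<close>
    accounts for the separate diagonal term exactly once.\<close>
  define J where "J = (\<lambda>P i. if same_part P i i then {j\<in>?N. same_part P j i \<and> j \<noteq> i}
      else insert i {j\<in>?N. same_part P j j})"
  have fin_J: "finite (J P i)" for P i by (simp add: J_def)
  \<comment> \<open>Expanding the product chooses one column per row, that is, a map
    \<open>f\<close>; the maps arising from \<open>P\<close> are those with which \<open>P\<close>
    is compatible.\<close>
  have J_eq: "{f. f \<in> ?N \<rightarrow>\<^sub>E ?N \<and> P \<in> compatible n f} = PiE ?N (J P)" if "P \<in> partial_partitions n" for P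
  proof -
    have "(\<forall>i\<in>?N. f i \<in> J P i) \<longleftrightarrow> (\<forall>i\<in>?N. f i \<in> ?N) \<and> P \<in> compatible n f" for f
      using that by (auto simp: compatible_def J_def split: if_splits)
    then show ?thesis unfolding set_eq_iff mem_Collect_eq PiE_iff by blast
  qed
  have "(\<Sum>P\<in>partial_partitions n. ?w P *
      (\<Prod>i=1..n.
        if same_part P i i
        then (\<Sum>j\<in>{j\<in>{1..n}. same_part P j i \<and> j \<noteq> i}. entry A i j)
        else entry A i i + (\<Sum>j\<in>{j\<in>{1..n}. same_part P j j}. entry A i j)))
    = (\<Sum>P\<in>partial_partitions n. ?w P * (\<Prod>i\<in>?N. \<Sum>j\<in>J P i. entry A i j))"
    by (intro sum.cong prod.cong arg_cong2[where f = times] refl) (auto simp: J_def)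
  also have "\<dots> = (\<Sum>P\<in>partial_partitions n. \<Sum>f | f \<in> ?N \<rightarrow>\<^sub>E ?N \<and> P \<in> compatible n f. ?w P * ?a f)"
    by (intro sum.cong refl) (simp only: prod_sum_PiE[OF finite_atLeastAtMost fin_J] J_eq sum_distrib_left)
  also have "\<dots> = (\<Sum>f\<in>?N \<rightarrow>\<^sub>E ?N. \<Sum>P | P \<in> partial_partitions n \<and> P \<in> compatible n f. ?w P * ?a f)"
    by (rule sum.swap_restrict) (auto simp: finite_partial_partitions intro!: finite_PiE)
  also have "\<dots> = (\<Sum>f\<in>?N \<rightarrow>\<^sub>E ?N. (\<Sum>P\<in>compatible n f. ?w P) * ?a f)"
    unfolding sum_distrib_right by (intro sum.cong) (auto simp: compatible_def)
  also have "\<dots> = (\<Sum>f\<in>{f\<in>?N \<rightarrow>\<^sub>E ?N. f ` ?N = ?N}. (\<Sum>P\<in>compatible n f. ?w P) * ?a f)"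
  proof (rule sum.mono_neutral_right)
    show "\<forall>f\<in>(?N \<rightarrow>\<^sub>E ?N) - {f\<in>?N \<rightarrow>\<^sub>E ?N. f ` ?N = ?N}. (\<Sum>P\<in>compatible n f. ?w P) * ?a f = 0"
    proof
      fix f assume f: "f \<in> (?N \<rightarrow>\<^sub>E ?N) - {f\<in>?N \<rightarrow>\<^sub>E ?N. f ` ?N = ?N}"
      then have sub: "f ` ?N \<subseteq> ?N" by auto
      with f obtain x where "x \<in> ?N" "x \<notin> f ` ?N" by blast
      with sub have "(\<Sum>P\<in>compatible n f. ?w P) = 0"
        by (rule sum_compatible_not_surj)
      then show "(\<Sum>P\<in>compatible n f. ?w P) * ?a f = 0" by simp
    qed
  qed (auto intro!: finite_PiE)
  also have "\<dots> = (\<Sum>p | p permutes ?N. of_int (sign p) * ?a p)"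
  \<comment> \<open>Extensional functions are \<open>undefined\<close> outside
    \<open>{1..n}\<close>, whereas permutations are the identity there. Both
    \<open>compatible\<close> and the product see only the values on \<open>{1..n}\<close>.\<close>
  proof (rule sum.reindex_bij_witness[where j = "\<lambda>f. restrict_id f ?N" and i = "\<lambda>p. restrict p ?N"],
      goal_cases)
    case (1 f)
    then show ?case by (auto simp: restrict_id_def fun_eq_iff PiE_def extensional_def)
  next
    case (2 f)
    then have "bij_betw f ?N ?N" by (auto simp: bij_betw_def intro: finite_surj_inj)
    then show ?case by (simp add: permutes_restrict_id)
  next
    case (3 p)
    then show ?case by (auto simp: restrict_id_def fun_eq_iff permutes_not_in)
  next
    case (4 p)
    then have "p ` ?N = ?N" using permutes_image by blast
    then show ?case by auto
  next
    case (5 f)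
    then have "bij_betw f ?N ?N" by (auto simp: bij_betw_def intro: finite_surj_inj)
    then have "restrict_id f ?N permutes ?N" by (rule permutes_restrict_id)
    then have "(\<Sum>P\<in>compatible n (restrict_id f ?N). ?w P) = of_int (sign (restrict_id f ?N))"
      by (rule sum_compatible_permutation)
    moreover have "compatible n (restrict_id f ?N) = compatible n f"
      by (simp add: compatible_def)
    moreover have "?a (restrict_id f ?N) = ?a f"
      by simp
    ultimately show ?case by simp
  qed
  also have "\<dots> = det A" using det_entry[OF assms(2)] by simp
  finally show ?thesis by simp
qed

end
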